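(* Let $G$ and $H$ be nontrivial connected graphs. The disjunctive product $G \vee H$ is well-dominated if and only if at least one of $G$ or $H$ is a complete graph and the other factor is well-dominated with domination number at most $2$.
   Context: All graphs are finite and simple. A graph is nontrivial if it has at least $2$ vertices. A set $D\subseteq V(G)$ is a dominating set of $G$ if every vertex of $G$ is in $D$ or adjacent to a vertex of $D$. The domination number $\gamma(G)$ is the minimum cardinality of a dominating set. A graph is well-dominated if all of its minimal (with respect to inclusion) dominating sets have the same cardinality. The disjunctive product $G\vee H$ has vertex set $V(G)\times V(H)$, and distinct vertices $(g_1,h_1)$, $(g_2,h_2)$ are adjacent iff $g_1g_2\in E(G)$ or $h_1h_2\in E(H)$. *)

theory Defs
  imports "Graph_Theory.Graph_Theory"
begin

text \<open>
  Finite simple graphs are the \<open>pair_graph\<close>s of the AFP entry on graph theory: a finite vertex set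
  with a symmetric irreflexive set of arcs, an edge \<open>uv\<close> being the two arcs \<open>(u,v)\<close> and \<open>(v,u)\<close>.
\<close>

definition complete_graph :: "'a pair_pre_digraph \<Rightarrow> bool" where
  "complete_graph G \<longleftrightarrow> complete_digraph (card (pverts G)) (with_proj G)"

definition dominating_set :: "'a pair_pre_digraph \<Rightarrow> 'a set \<Rightarrow> bool" where
  "dominating_set G D \<longleftrightarrow>
     D \<subseteq> pverts G \<and> (\<forall>v\<in>pverts G. v \<in> D \<or> (\<exists>u\<in>D. (u, v) \<in> parcs G))"

definition minimal_dominating_set :: "'a pair_pre_digraph \<Rightarrow> 'a set \<Rightarrow> bool" where
  "minimal_dominating_set G D \<longleftrightarrow>
     dominating_set G D \<and> (\<forall>D'. D' \<subset> D \<longrightarrow> \<not> dominating_set G D')"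

definition domination_number :: "'a pair_pre_digraph \<Rightarrow> nat" where
  "domination_number G = Min (card ` {D. dominating_set G D})"

definition well_dominated :: "'a pair_pre_digraph \<Rightarrow> bool" where
  "well_dominated G \<longleftrightarrow>
     (\<forall>D D'. minimal_dominating_set G D \<longrightarrow> minimal_dominating_set G D' \<longrightarrow> card D = card D')"

definition disjunctive_product ::
  "'a pair_pre_digraph \<Rightarrow> 'b pair_pre_digraph \<Rightarrow> ('a \<times> 'b) pair_pre_digraph" where
  "disjunctive_product G H =
     \<lparr> pverts = pverts G \<times> pverts H,
       parcs = {((g\<^sub>1, h\<^sub>1), (g\<^sub>2, h\<^sub>2)) | g\<^sub>1 h\<^sub>1 g\<^sub>2 h\<^sub>2.
         (g\<^sub>1, h\<^sub>1) \<in> pverts G \<times> pverts H \<and> (g\<^sub>2, h\<^sub>2) \<in> pverts G \<times> pverts H \<and>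
         (g\<^sub>1, h\<^sub>1) \<noteq> (g\<^sub>2, h\<^sub>2) \<and> ((g\<^sub>1, g\<^sub>2) \<in> parcs G \<or> (h\<^sub>1, h\<^sub>2) \<in> parcs H)} \<rparr>"

lemma pair_graph_disjunctive_product:
  assumes "pair_graph G" "pair_graph H"
  shows "pair_graph (disjunctive_product G H)"
proof -
  interpret G: pair_graph G by fact
  interpret H: pair_graph H by fact
  let ?P = "disjunctive_product G H"
  have fin: "finite (pverts ?P)"
    by (simp add: disjunctive_product_def G.pair_finite_verts H.pair_finite_verts)
  have sub: "parcs ?P \<subseteq> pverts ?P \<times> pverts ?P"
    by (auto simp: disjunctive_product_def)
  have fin': "finite (parcs ?P)"
    using finite_subset[OF sub] fin by blast
  have "sym (parcs ?P)"
    by (auto simp: disjunctive_product_def sym_def dest: G.arcs_symmetric H.arcs_symmetric)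
  moreover have "fst e \<noteq> snd e" if "e \<in> parcs ?P" for e
    using that by (auto simp: disjunctive_product_def)
  ultimately show ?thesis
    using fin fin' sub by unfold_locales (auto simp: symmetric_def)
qed

end

theory Submission
  imports Defs
begin

text \<open>
  If \<open>I\<close> and \<open>J\<close> are maximal independent sets of \<open>G\<close> and \<open>H\<close>, then \<open>I \<times> J\<close> is a minimal dominating
  set of \<open>G \<or> H\<close>. Suppose that neither factor is complete, so that \<open>J\<close> can be chosen with
  \<open>|J| \<ge> 2\<close>. Since \<open>G\<close> is connected, it has an induced path \<open>i c j\<close>; let \<open>I\<close> contain \<open>i\<close> and \<open>j\<close>.
  Adding to \<open>I\<close> the vertex \<open>c\<close> and one neighbour of each other vertex of \<open>I\<close> gives a set \<open>T\<close> with
  \<open>|T| \<le> 2|I| - 1\<close> in which every vertex of \<open>G\<close> has a neighbour. Then \<open>T \<times> {h}\<close> dominates \<open>G \<or> H\<close>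
  and is smaller than \<open>I \<times> J\<close>, so \<open>G \<or> H\<close> is not well-dominated.

  If \<open>G\<close> is complete, any two vertices with distinct first coordinates dominate \<open>G \<or> H\<close>, and
  \<open>{g} \<times> D\<close> dominates \<open>G \<or> H\<close> exactly when \<open>D\<close> dominates \<open>H\<close>; so the minimal dominating sets are
  copies of those of \<open>H\<close> and some sets of size 2.
\<close>

section \<open>Dominating and independent sets\<close>

definition independent_set :: "'a pair_pre_digraph \<Rightarrow> 'a set \<Rightarrow> bool" where
  "independent_set G I \<longleftrightarrow> I \<subseteq> pverts G \<and> (\<forall>u\<in>I. \<forall>v\<in>I. (u, v) \<notin> parcs G)"

lemma pair_graph_sym:
  assumes "pair_graph G" "(u, v) \<in> parcs G"
  shows "(v, u) \<in> parcs G"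
proof -
  interpret pair_graph G by fact
  show ?thesis using assms(2) arcs_symmetric by simp
qed

lemma pair_graph_irrefl:
  assumes "pair_graph G"
  shows "(v, v) \<notin> parcs G"
proof -
  interpret pair_graph G by fact
  show ?thesis using no_loops' by blast
qed

lemma pair_graph_arc_verts:
  assumes "pair_graph G" "(u, v) \<in> parcs G"
  shows "u \<in> pverts G" "v \<in> pverts G"
proof -
  interpret pair_graph G by fact
  show "u \<in> pverts G" "v \<in> pverts G" using assms(2) in_arcsD1 in_arcsD2 by blast+
qed

lemma pair_graph_finite: "pair_graph G \<Longrightarrow> finite (pverts G)"
proof -
  assume "pair_graph G"
  then interpret pair_graph G .
  show ?thesis by (rule pair_finite_verts)
qed

lemma dominating_set_pverts: "dominating_set G (pverts G)"
  by (simp add: dominating_set_def)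

lemma dominating_set_finite: "\<lbrakk>pair_graph G; dominating_set G D\<rbrakk> \<Longrightarrow> finite D"
  using pair_graph_finite[of G] finite_subset[of D "pverts G"] by (auto simp: dominating_set_def)

lemma minimal_dominating_subset:
  assumes "pair_graph G" "dominating_set G D"
  obtains M where "M \<subseteq> D" "minimal_dominating_set G M"
proof -
  let ?A = "{M. M \<subseteq> D \<and> dominating_set G M}"
  have "finite ?A"
    using dominating_set_finite[OF assms] by simp
  moreover have "D \<in> ?A" using assms(2) by simp
  ultimately obtain M where "M \<in> ?A" "\<forall>B\<in>?A. B \<subseteq> M \<longrightarrow> M = B"
    using finite_has_minimal[of ?A] by blast
  then have "M \<subseteq> D" "minimal_dominating_set G M"
    unfolding minimal_dominating_set_def by auto
  then show ?thesis by (rule that)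
qed

lemma minimal_dominating_setD:
  "\<lbrakk>minimal_dominating_set G D; dominating_set G D'; D' \<subseteq> D\<rbrakk> \<Longrightarrow> D' = D"
  by (auto simp: minimal_dominating_set_def)

lemma well_dominatedD:
  "\<lbrakk>well_dominated G; minimal_dominating_set G D; minimal_dominating_set G D'\<rbrakk>
    \<Longrightarrow> card D = card D'"
  unfolding well_dominated_def by blast

text \<open>\<open>D'\<close> contains a minimal dominating set, whose size is that of
  \<open>D\<close>. One small dominating set can therefore refute well-domination.\<close>

lemma well_dominated_card_le:
  assumes "pair_graph G" "well_dominated G" "minimal_dominating_set G D" "dominating_set G D'"
  shows "card D \<le> card D'"
proof -
  obtain M where M: "M \<subseteq> D'" "minimal_dominating_set G M"
    using minimal_dominating_subset[OF assms(1,4)] .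
  then have "card D = card M" using well_dominatedD[OF assms(2,3)] by blast
  then show ?thesis using M(1) dominating_set_finite[OF assms(1,4)] by (simp add: card_mono)
qed

lemma domination_number_eq_card:
  assumes "pair_graph G" "well_dominated G" "minimal_dominating_set G D"
  shows "domination_number G = card D"
  unfolding domination_number_def
proof (rule Min_eqI)
  have "{D. dominating_set G D} \<subseteq> Pow (pverts G)" by (auto simp: dominating_set_def)
  then show "finite (card ` {D. dominating_set G D})"
    using pair_graph_finite[OF assms(1)] by (simp add: finite_subset)
  show "card D \<le> n" if "n \<in> card ` {D. dominating_set G D}" for n
    using that well_dominated_card_le[OF assms] by blast
  show "card D \<in> card ` {D. dominating_set G D}"
    using assms(3) unfolding minimal_dominating_set_def by blast
qed

text \<open>A vertex dropped from \<open>I\<close> would need a neighbour among the remaining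
  vertices of \<open>I\<close>, against independence.\<close>

lemma independent_dominating_set_minimal:
  assumes "independent_set G I" "dominating_set G I"
  shows "minimal_dominating_set G I"
  unfolding minimal_dominating_set_def
proof (intro conjI allI impI notI)
  fix D assume "D \<subset> I" and D: "dominating_set G D"
  then obtain v where v: "v \<in> I" "v \<notin> D" and sub: "D \<subseteq> I" by blast
  then have "v \<in> pverts G" using assms(1) by (auto simp: independent_set_def)
  then obtain u where "u \<in> D" "(u, v) \<in> parcs G"
    using D v(2) by (auto simp: dominating_set_def)
  then show False using assms(1) v(1) sub by (auto simp: independent_set_def)
qed (rule assms(2))

text \<open>A maximal independent superset dominates, since an undominated vertex could be added to
  it.\<close>

lemma independent_set_extends:
  assumes "pair_graph G" "independent_set G I"
  obtains J where "I \<subseteq> J" "independent_set G J" "dominating_set G J"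
proof -
  let ?A = "{J. I \<subseteq> J \<and> independent_set G J}"
  have "?A \<subseteq> Pow (pverts G)" by (auto simp: independent_set_def)
  then have "finite ?A"
    by (rule finite_subset) (simp add: pair_graph_finite[OF assms(1)])
  moreover have "I \<in> ?A" using assms(2) by simp
  ultimately obtain J where J: "J \<in> ?A" and max: "\<forall>B\<in>?A. J \<subseteq> B \<longrightarrow> J = B"
    using finite_has_maximal[of ?A] by blast
  have "dominating_set G J"
    unfolding dominating_set_def
  proof (intro conjI ballI)
    show "J \<subseteq> pverts G" using J by (simp add: independent_set_def)
    show "v \<in> J \<or> (\<exists>u\<in>J. (u, v) \<in> parcs G)" if "v \<in> pverts G" for v
    proof (rule ccontr)
      assume neg: "\<not> ?thesis"
      then have "insert v J \<in> ?A"
        using J that pair_graph_irrefl[OF assms(1)] pair_graph_sym[OF assms(1), of v]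
        by (auto simp: independent_set_def)
      with max neg show False by blast
    qed
  qed
  with J that show ?thesis by blast
qed

section \<open>Complete graphs, and connected graphs that are not complete\<close>

lemma complete_graph_iff:
  assumes "pair_graph G"
  shows "complete_graph G \<longleftrightarrow> (\<forall>u\<in>pverts G. \<forall>v\<in>pverts G. u \<noteq> v \<longrightarrow> (u, v) \<in> parcs G)"
proof -
  interpret pair_graph G by fact
  have "graph (with_proj G)" by unfold_locales
  then have "complete_graph G \<longleftrightarrow>
      parcs G = {(u, v). (u, v) \<in> pverts G \<times> pverts G \<and> u \<noteq> v}"
    by (simp add: complete_graph_def complete_digraph_def)
  moreover have "parcs G \<subseteq> {(u, v). (u, v) \<in> pverts G \<times> pverts G \<and> u \<noteq> v}"
    by (auto dest: in_arcsD1 in_arcsD2 simp: pair_graph_irrefl[OF assms])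
  ultimately show ?thesis by blast
qed

text \<open>If no such path starts at \<open>a\<close>, then \<open>a\<close> and its neighbours
  form a set closed under arcs; by connectedness it contains every vertex, including the
  non-neighbour \<open>b\<close>.\<close>

lemma connected_not_complete_induced_path:
  assumes "pair_graph G" "connected (with_proj G)" "\<not> complete_graph G"
  obtains i c j where "(i, c) \<in> parcs G" "(c, j) \<in> parcs G" "i \<noteq> j" "(i, j) \<notin> parcs G"
proof -
  interpret pair_graph G by fact
  have "strongly_connected (with_proj G)"
    using symmetric_connected_imp_strongly_connected sym_arcs assms(2) by blast
  then have reach: "reachable (with_proj G) u v" if "u \<in> pverts G" "v \<in> pverts G" for u v
    using that by (simp add: strongly_connected_def)
  obtain a b where ab: "a \<in> pverts G" "b \<in> pverts G" "a \<noteq> b" "(a, b) \<notin> parcs G"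
    using assms(3) complete_graph_iff[OF assms(1)] by blast
  have "\<exists>c j. (a, c) \<in> parcs G \<and> (c, j) \<in> parcs G \<and> a \<noteq> j \<and> (a, j) \<notin> parcs G"
  proof (rule ccontr)
    assume no: "\<not> ?thesis"
    have "(a, b) \<in> rtrancl_on (pverts G) (parcs G)"
      using reach[OF ab(1,2)] by (simp add: reachable_def)
    then have "a = b \<or> (a, b) \<in> parcs G"
      by (induction rule: rtrancl_on_induct) (use no in blast)+
    with ab show False by blast
  qed
  with that show ?thesis by blast
qed

lemma ex_other_member:
  assumes "2 \<le> card A"
  obtains w where "w \<in> A" "w \<noteq> v"
proof -
  have "\<not> A \<subseteq> {v}" using card_mono[of "{v}" A] assms by auto
  with that show ?thesis by blast
qed

lemma connected_ex_neighbour: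
  assumes "pair_graph G" "connected (with_proj G)" "2 \<le> card (pverts G)" "v \<in> pverts G"
  obtains u where "(u, v) \<in> parcs G"
proof -
  interpret pair_graph G by fact
  have sc: "strongly_connected (with_proj G)"
    using symmetric_connected_imp_strongly_connected sym_arcs assms(2) by blast
  obtain w where w: "w \<in> pverts G" "w \<noteq> v"
    using ex_other_member[OF assms(3)] .
  have "(w, v) \<in> rtrancl_on (pverts G) (parcs G)"
    using sc w(1) assms(4) by (simp add: reachable_def strongly_connected_def)
  then have "\<exists>u. (u, v) \<in> parcs G"
    \<comment> \<open>The last arc of a walk from \<open>w\<close> to \<open>v\<close> supplies the
      neighbour.\<close>
    using w(2) by (cases rule: rtrancl_on.cases) auto
  with that show ?thesis by blast
qed

lemma small_total_dominating_set:
  assumes "pair_graph G" "connected (with_proj G)" "2 \<le> card (pverts G)" "\<not> complete_graph G"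
  obtains I T where "independent_set G I" "dominating_set G I"
    "T \<subseteq> pverts G" "\<forall>v\<in>pverts G. \<exists>u\<in>T. (u, v) \<in> parcs G" "card T < 2 * card I"
proof -
  obtain i c j where P: "(i, c) \<in> parcs G" "(c, j) \<in> parcs G" "i \<noteq> j" "(i, j) \<notin> parcs G"
    using connected_not_complete_induced_path[OF assms(1,2,4)] .
  note sym = pair_graph_sym[OF assms(1)] and verts = pair_graph_arc_verts[OF assms(1)]
  have "independent_set G {i, j}"
    using P(4) verts(1)[OF P(1)] verts(2)[OF P(2)] sym[of j i] pair_graph_irrefl[OF assms(1)]
    by (auto simp: independent_set_def)
  then obtain I where I: "{i, j} \<subseteq> I" "independent_set G I" "dominating_set G I"
    using independent_set_extends[OF assms(1)] by metis
  have sub: "I \<subseteq> pverts G" using I(2) by (simp add: independent_set_def)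
  have fin: "finite I" using dominating_set_finite[OF assms(1) I(3)] .
  have "\<forall>v\<in>pverts G. \<exists>u. (u, v) \<in> parcs G"
    using connected_ex_neighbour[OF assms(1-3)] by blast
  then obtain f where f: "\<And>v. v \<in> pverts G \<Longrightarrow> (f v, v) \<in> parcs G" by metis
  \<comment> \<open>Vertices outside \<open>I\<close> have neighbours in \<open>I\<close>;
    \<open>c\<close> serves both \<open>i\<close> and \<open>j\<close>, and this sharing makes the
    bound strict; \<open>f\<close> serves the rest of \<open>I\<close>.\<close>
  let ?T = "I \<union> insert c (f ` (I - {i, j}))"
  have "?T \<subseteq> pverts G" using sub verts(1)[OF f] verts(1)[OF P(2)] by auto
  moreover have "\<exists>u\<in>?T. (u, v) \<in> parcs G" if v: "v \<in> pverts G" for v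
  proof (cases "v \<in> I")
    case True
    consider "v = i" | "v = j" | "v \<in> I - {i, j}" using True by blast
    then show ?thesis
    proof cases
      case 1
      then show ?thesis using sym[OF P(1)] by blast
    next
      case 2
      then show ?thesis using P(2) by blast
    next
      case 3
      then show ?thesis using f[OF v] by blast
    qed
  next
    case False
    then show ?thesis using I(3) v by (auto simp: dominating_set_def)
  qed
  moreover have "card ?T < 2 * card I"
  proof -
    \<comment> \<open>The second fact rules out truncation in the subtraction, so the total is at
      most \<open>2 * card I - 1\<close>.\<close>
    have two: "card (I - {i, j}) = card I - 2" "2 \<le> card I"
      using card_Diff_subset[of "{i, j}" I] card_mono[OF fin I(1)] I(1) P(3) by auto
    have "card ?T \<le> card I + card (insert c (f ` (I - {i, j})))" by (rule card_Un_le)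
    also have "\<dots> \<le> card I + Suc (card (f ` (I - {i, j})))"
      using card_insert_le_m1 by (simp add: card_insert_if fin)
    also have "\<dots> \<le> card I + Suc (card (I - {i, j}))"
      using card_image_le[of "I - {i, j}" f] fin by simp
    also have "\<dots> < 2 * card I" using two by simp
    finally show ?thesis .
  qed
  ultimately show ?thesis using that I(2,3) by blast
qed

section \<open>Domination in disjunctive products\<close>

lemma pverts_disjunctive_product [simp]:
  "pverts (disjunctive_product G H) = pverts G \<times> pverts H"
  by (simp add: disjunctive_product_def)

text \<open>Distinctness of the endpoints disappears because an arc in either coordinate already
  forces it.\<close>

lemma parcs_disjunctive_product_iff:
  assumes "pair_graph G" "pair_graph H"
  shows "((g, h), (g', h')) \<in> parcs (disjunctive_product G H) \<longleftrightarrow>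
    g \<in> pverts G \<and> g' \<in> pverts G \<and> h \<in> pverts H \<and> h' \<in> pverts H \<and>
    ((g, g') \<in> parcs G \<or> (h, h') \<in> parcs H)"
  using pair_graph_irrefl[OF assms(1)] pair_graph_irrefl[OF assms(2)]
  by (auto simp: disjunctive_product_def)

lemma dominating_set_disjunctive_product_iff:
  assumes "pair_graph G" "pair_graph H"
  shows "dominating_set (disjunctive_product G H) D \<longleftrightarrow> D \<subseteq> pverts G \<times> pverts H \<and>
    (\<forall>x\<in>pverts G. \<forall>y\<in>pverts H.
      (x, y) \<in> D \<or> (\<exists>(g, h)\<in>D. (g, x) \<in> parcs G \<or> (h, y) \<in> parcs H))"
proof (cases "D \<subseteq> pverts G \<times> pverts H")
  case True
  then have "(\<exists>u\<in>D. (u, (x, y)) \<in> parcs (disjunctive_product G H)) \<longleftrightarrow>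
      (\<exists>(g, h)\<in>D. (g, x) \<in> parcs G \<or> (h, y) \<in> parcs H)"
    if "x \<in> pverts G" "y \<in> pverts H" for x y
    using that
    by (intro bex_cong refl) (auto simp: parcs_disjunctive_product_iff[OF assms])
  with True show ?thesis by (simp add: dominating_set_def)
qed (simp add: dominating_set_def)

lemma independent_dominating_product:
  assumes "pair_graph G" "pair_graph H"
    and "independent_set G I" "dominating_set G I" "independent_set H J" "dominating_set H J"
  shows "minimal_dominating_set (disjunctive_product G H) (I \<times> J)"
proof (rule independent_dominating_set_minimal)
  show "independent_set (disjunctive_product G H) (I \<times> J)"
    using assms(3,5) by (auto simp: independent_set_def parcs_disjunctive_product_iff[OF assms(1,2)])
  have I: "I \<subseteq> pverts G" "\<And>x. x \<in> pverts G \<Longrightarrow> x \<in> I \<or> (\<exists>u\<in>I. (u, x) \<in> parcs G)"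
    and J: "J \<subseteq> pverts H" "\<And>y. y \<in> pverts H \<Longrightarrow> y \<in> J \<or> (\<exists>u\<in>J. (u, y) \<in> parcs H)"
    using assms(4,6) by (simp_all add: dominating_set_def)
  show "dominating_set (disjunctive_product G H) (I \<times> J)"
    unfolding dominating_set_disjunctive_product_iff[OF assms(1,2)]
  proof (intro conjI ballI)
    show "I \<times> J \<subseteq> pverts G \<times> pverts H" using I(1) J(1) by blast
    fix x y assume "x \<in> pverts G" "y \<in> pverts H"
    \<comment> \<open>Domination in one coordinate suffices; either alternative for the other
      coordinate supplies a member of its set to complete the pair.\<close>
    from I(2)[OF this(1)] J(2)[OF this(2)]
    show "(x, y) \<in> I \<times> J \<or> (\<exists>(g, h)\<in>I \<times> J. (g, x) \<in> parcs G \<or> (h, y) \<in> parcs H)"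
      by blast
  qed
qed

text \<open>The first coordinate alone provides an arc to every vertex, so one copy of
  \<open>T\<close> is enough.\<close>

lemma total_dominating_product:
  assumes "pair_graph G" "pair_graph H" "h \<in> pverts H"
    and "T \<subseteq> pverts G" "\<forall>v\<in>pverts G. \<exists>u\<in>T. (u, v) \<in> parcs G"
  shows "dominating_set (disjunctive_product G H) (T \<times> {h})"
  unfolding dominating_set_disjunctive_product_iff[OF assms(1,2)]
proof (intro conjI ballI disjI2)
  show "T \<times> {h} \<subseteq> pverts G \<times> pverts H" using assms(3,4) by blast
  fix x assume "x \<in> pverts G"
  then obtain u where "u \<in> T" "(u, x) \<in> parcs G" using assms(5) by blast
  then show "\<exists>(g, h)\<in>T \<times> {h}. (g, x) \<in> parcs G \<or> (h, y) \<in> parcs H" for y by auto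
qed

text \<open>Two non-complete factors would give a minimal dominating set of size at least
  \<open>2 * card I\<close> and a dominating set of smaller size.\<close>

lemma well_dominated_disjunctive_product_imp_complete:
  assumes "pair_graph G" "pair_graph H" "connected (with_proj G)" "2 \<le> card (pverts G)"
    and wd: "well_dominated (disjunctive_product G H)" and nG: "\<not> complete_graph G"
  shows "complete_graph H"
proof (rule ccontr)
  assume "\<not> complete_graph H"
  then obtain a b where ab: "a \<in> pverts H" "b \<in> pverts H" "a \<noteq> b" "(a, b) \<notin> parcs H"
    using complete_graph_iff[OF assms(2)] by blast
  then have "independent_set H {a, b}"
    using pair_graph_sym[OF assms(2), of b a] pair_graph_irrefl[OF assms(2)]
    by (auto simp: independent_set_def)
  then obtain J where J: "{a, b} \<subseteq> J" "independent_set H J" "dominating_set H J"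
    using independent_set_extends[OF assms(2)] by metis
  have J2: "2 \<le> card J"
    using card_mono[OF dominating_set_finite[OF assms(2) J(3)] J(1)] ab(3) by simp
  obtain I T where I: "independent_set G I" "dominating_set G I"
    and T: "T \<subseteq> pverts G" "\<forall>v\<in>pverts G. \<exists>u\<in>T. (u, v) \<in> parcs G" "card T < 2 * card I"
    using small_total_dominating_set[OF assms(1,3,4) nG] .
  have "card (I \<times> J) \<le> card (T \<times> {a})"
    using well_dominated_card_le[OF pair_graph_disjunctive_product[OF assms(1,2)] wd]
      independent_dominating_product[OF assms(1,2) I J(2,3)]
      total_dominating_product[OF assms(1,2) ab(1) T(1,2)] by blast
  then have "card I * card J \<le> card T" by (simp add: card_cartesian_product)
  moreover have "card I * 2 \<le> card I * card J" using J2 by simp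
  ultimately show False using T(3) by linarith
qed

section \<open>Products with a complete factor\<close>

lemma dominating_set_fibre_iff:
  assumes "pair_graph G" "pair_graph H" "complete_graph G" "g \<in> pverts G" "pverts H \<noteq> {}"
  shows "dominating_set (disjunctive_product G H) ({g} \<times> D) \<longleftrightarrow> dominating_set H D"
proof
  assume L: "dominating_set (disjunctive_product G H) ({g} \<times> D)"
  show "dominating_set H D"
    unfolding dominating_set_def
  proof (intro conjI ballI)
    show "D \<subseteq> pverts H" using L by (auto simp: dominating_set_def)
    fix y assume "y \<in> pverts H"
    \<comment> \<open>Within the fibre over \<open>g\<close> only arcs of \<open>H\<close> can help,
      as \<open>g\<close> has no loop.\<close>
    then have "(g, y) \<in> {g} \<times> D \<or> (\<exists>(g', h)\<in>{g} \<times> D. (g', g) \<in> parcs G \<or> (h, y) \<in> parcs H)"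
      using L assms(4) unfolding dominating_set_disjunctive_product_iff[OF assms(1,2)] by blast
    then show "y \<in> D \<or> (\<exists>u\<in>D. (u, y) \<in> parcs H)"
      using pair_graph_irrefl[OF assms(1), of g] by blast
  qed
next
  assume R: "dominating_set H D"
  \<comment> \<open>By completeness of \<open>G\<close>, the vertex \<open>(g, d)\<close> dominates
    everything outside the fibre over \<open>g\<close>.\<close>
  then obtain d where d: "d \<in> D" using assms(5) by (auto simp: dominating_set_def)
  show "dominating_set (disjunctive_product G H) ({g} \<times> D)"
    unfolding dominating_set_disjunctive_product_iff[OF assms(1,2)]
  proof (intro conjI ballI)
    show "{g} \<times> D \<subseteq> pverts G \<times> pverts H" using R assms(4) by (auto simp: dominating_set_def)
    fix x y assume x: "x \<in> pverts G" and "y \<in> pverts H"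
    then have "y \<in> D \<or> (\<exists>u\<in>D. (u, y) \<in> parcs H)" using R by (simp add: dominating_set_def)
    moreover have "x = g \<or> (g, x) \<in> parcs G"
      using assms(3,4) x complete_graph_iff[OF assms(1)] by metis
    ultimately show "(x, y) \<in> {g} \<times> D \<or>
        (\<exists>(g', h)\<in>{g} \<times> D. (g', x) \<in> parcs G \<or> (h, y) \<in> parcs H)"
      using d by blast
  qed
qed

lemma minimal_dominating_set_fibre_iff:
  assumes "pair_graph G" "pair_graph H" "complete_graph G" "g \<in> pverts G" "pverts H \<noteq> {}"
  shows "minimal_dominating_set (disjunctive_product G H) ({g} \<times> D) \<longleftrightarrow>
    minimal_dominating_set H D"
proof -
  \<comment> \<open>Proper subsets of the fibre copy are exactly the copies of proper subsets of
    \<open>D\<close>.\<close>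
  have "(\<forall>D'. D' \<subset> {g} \<times> D \<longrightarrow> P D') \<longleftrightarrow> (\<forall>D'. D' \<subset> D \<longrightarrow> P ({g} \<times> D'))" for P
  proof (intro iffI allI impI)
    fix D' assume "\<forall>D'. D' \<subset> D \<longrightarrow> P ({g} \<times> D')" "D' \<subset> {g} \<times> D"
    moreover from this have "D' = {g} \<times> snd ` D'" by force
    moreover from calculation have "snd ` D' \<subset> D" by blast
    ultimately show "P D'" by metis
  next
    fix D' assume "\<forall>D'. D' \<subset> {g} \<times> D \<longrightarrow> P D'" "D' \<subset> D"
    moreover from this(2) have "{g} \<times> D' \<subset> {g} \<times> D" by blast
    ultimately show "P ({g} \<times> D')" by simp
  qed
  then show ?thesis
    by (simp only: minimal_dominating_set_def dominating_set_fibre_iff[OF assms])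
qed

text \<open>Each \<open>x\<close> differs from \<open>g\<close> or from \<open>g'\<close>, hence is
  adjacent to one of them.\<close>

lemma dominating_set_pair:
  assumes "pair_graph G" "pair_graph H" "complete_graph G"
    and "g \<in> pverts G" "g' \<in> pverts G" "g \<noteq> g'" "h \<in> pverts H" "h' \<in> pverts H"
  shows "dominating_set (disjunctive_product G H) {(g, h), (g', h')}"
  unfolding dominating_set_disjunctive_product_iff[OF assms(1,2)]
proof (intro conjI ballI disjI2)
  show "{(g, h), (g', h')} \<subseteq> pverts G \<times> pverts H" using assms(4,5,7,8) by blast
  fix x y assume "x \<in> pverts G"
  then have "(g, x) \<in> parcs G \<or> (g', x) \<in> parcs G"
    using assms(3-6) complete_graph_iff[OF assms(1)] by metis
  then show "\<exists>(a, b)\<in>{(g, h), (g', h')}. (a, x) \<in> parcs G \<or> (b, y) \<in> parcs H" by blast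
qed

lemma well_dominated_complete_product_iff:
  assumes "pair_graph G" "pair_graph H" "complete_graph G" "2 \<le> card (pverts G)"
    and ne: "pverts H \<noteq> {}"
  shows "well_dominated (disjunctive_product G H) \<longleftrightarrow>
    well_dominated H \<and> domination_number H \<le> 2"
proof
  let ?P = "disjunctive_product G H"
  note P = pair_graph_disjunctive_product[OF assms(1,2)]
  obtain g where "g \<in> pverts G" using assms(4) by fastforce
  moreover obtain g' where "g' \<in> pverts G" "g' \<noteq> g" using ex_other_member[OF assms(4)] .
  ultimately have g: "g \<in> pverts G" "g' \<in> pverts G" "g \<noteq> g'" by simp_all
  obtain h where h: "h \<in> pverts H" using ne by blast
  note fibre = minimal_dominating_set_fibre_iff[OF assms(1-3) _ ne]
  assume wd: "well_dominated ?P"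
  have wdH: "well_dominated H"
    unfolding well_dominated_def
  proof (intro allI impI)
    fix D D' assume "minimal_dominating_set H D" "minimal_dominating_set H D'"
    then have "card ({g} \<times> D) = card ({g} \<times> D')"
      using well_dominatedD[OF wd] fibre[OF g(1)] by blast
    then show "card D = card D'" by (simp add: card_cartesian_product)
  qed
  obtain D where D: "minimal_dominating_set H D"
    using minimal_dominating_subset[OF assms(2) dominating_set_pverts] .
  \<comment> \<open>The bound 2 on the domination number comes from comparing a fibre copy with a
    dominating pair.\<close>
  have "card ({g} \<times> D) \<le> card {(g, h), (g', h)}"
    using well_dominated_card_le[OF P wd] fibre[OF g(1)] D
      dominating_set_pair[OF assms(1-3) g h h] by blast
  also have "\<dots> = 2" using g(3) by simp
  finally have "card D \<le> 2" by (simp add: card_cartesian_product)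
  then show "well_dominated H \<and> domination_number H \<le> 2"
    using wdH domination_number_eq_card[OF assms(2) wdH D] by simp
next
  let ?P = "disjunctive_product G H"
  assume wdH: "well_dominated H \<and> domination_number H \<le> 2"
  have "card D = domination_number H" if D: "minimal_dominating_set ?P D" for D
  proof -
    have dom: "dominating_set ?P D" using D by (simp add: minimal_dominating_set_def)
    then have sub: "D \<subseteq> pverts G \<times> pverts H" by (simp add: dominating_set_def)
    have "pverts G \<noteq> {}" using assms(4) by auto
    with dom ne obtain g h where gh: "(g, h) \<in> D"
      by (fastforce simp: dominating_set_def)
    then have g: "g \<in> pverts G" and h: "h \<in> pverts H" using sub by auto
    show ?thesis
    \<comment> \<open>Either \<open>D\<close> is a copy of a minimal dominating set of
      \<open>H\<close>, or it meets two fibres and minimality reduces it to a pair.\<close>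
    proof (cases "\<forall>p\<in>D. fst p = g")
      case True
      then have eq: "D = {g} \<times> snd ` D" by force
      then have "minimal_dominating_set H (snd ` D)"
        using D minimal_dominating_set_fibre_iff[OF assms(1-3) g ne] by metis
      then have "domination_number H = card (snd ` D)"
        using domination_number_eq_card[OF assms(2)] wdH by blast
      moreover have "card D = card (snd ` D)"
        using arg_cong[OF eq, of card] by (simp add: card_cartesian_product)
      ultimately show ?thesis by simp
    next
      case False
      then obtain g' h' where gh': "(g', h') \<in> D" "g' \<noteq> g" by auto
      then have "{(g, h), (g', h')} = D"
        using minimal_dominating_setD[OF D] dominating_set_pair[OF assms(1-3), of g g' h h']
          sub gh by blast
      then have card: "card D = 2" using gh'(2) by auto
      \<comment> \<open>It remains to exclude domination number 1. Choosing \<open>J\<close> through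
        \<open>h\<close> turns that case into \<open>J = {h}\<close>, and then \<open>(g, h)\<close>
        alone would dominate, against minimality of \<open>D\<close>.\<close>
      have "independent_set H {h}"
        using h pair_graph_irrefl[OF assms(2)] by (auto simp: independent_set_def)
      then obtain J where J: "{h} \<subseteq> J" "independent_set H J" "dominating_set H J"
        using independent_set_extends[OF assms(2)] by metis
      have cJ: "card J = domination_number H"
        using domination_number_eq_card[OF assms(2)] wdH
          independent_dominating_set_minimal[OF J(2,3)] by metis
      have "\<not> card J \<le> 1"
      proof
        assume "card J \<le> 1"
        then have "J = {h}"
          using card_seteq[OF dominating_set_finite[OF assms(2) J(3)] J(1)] by simp
        then have "dominating_set ?P ({g} \<times> {h})"
          using J(3) dominating_set_fibre_iff[OF assms(1-3) g ne] by blast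
        then have "{g} \<times> {h} = D" using minimal_dominating_setD[OF D] gh by blast
        then show False using gh' by blast
      qed
      then show ?thesis using cJ card wdH by simp
    qed
  qed
  then show "well_dominated ?P" unfolding well_dominated_def by presburger
qed

section \<open>Commutativity\<close>

lemma dominating_set_swap:
  assumes "pair_graph G" "pair_graph H" "dominating_set (disjunctive_product G H) D"
  shows "dominating_set (disjunctive_product H G) (prod.swap ` D)"
  unfolding dominating_set_disjunctive_product_iff[OF assms(2,1)]
proof (intro conjI ballI)
  note D = assms(3)[unfolded dominating_set_disjunctive_product_iff[OF assms(1,2)]]
  show "prod.swap ` D \<subseteq> pverts H \<times> pverts G" using D by auto
  fix y x assume "y \<in> pverts H" "x \<in> pverts G"
  with D consider "(x, y) \<in> D"
    | g h where "(g, h) \<in> D" "(g, x) \<in> parcs G \<or> (h, y) \<in> parcs H" by blast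
  then show "(y, x) \<in> prod.swap ` D \<or>
      (\<exists>(h, g)\<in>prod.swap ` D. (h, y) \<in> parcs H \<or> (g, x) \<in> parcs G)"
  proof cases
    case 1
    then show ?thesis by force
  next
    case 2
    moreover from 2(1) have "(h, g) \<in> prod.swap ` D" by force
    ultimately show ?thesis by blast
  qed
qed

text \<open>Swapping is an involution, so a smaller dominating subset of the image would swap back
  to one of \<open>D\<close>.\<close>

lemma minimal_dominating_set_swap:
  assumes "pair_graph G" "pair_graph H" "minimal_dominating_set (disjunctive_product G H) D"
  shows "minimal_dominating_set (disjunctive_product H G) (prod.swap ` D)"
  unfolding minimal_dominating_set_def
proof (intro conjI allI impI notI)
  show "dominating_set (disjunctive_product H G) (prod.swap ` D)"
    using dominating_set_swap[OF assms(1,2)] assms(3) by (simp add: minimal_dominating_set_def)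
  fix D' assume "D' \<subset> prod.swap ` D" and "dominating_set (disjunctive_product H G) D'"
  moreover have "prod.swap ` D' \<subset> D" if "D' \<subset> prod.swap ` D"
    using image_strict_mono[OF _ that, of prod.swap] by (simp add: image_image)
  ultimately show False
    using dominating_set_swap[OF assms(2,1)] assms(3) by (auto simp: minimal_dominating_set_def)
qed

lemma well_dominated_disjunctive_product_commute:
  assumes "pair_graph G" "pair_graph H" "well_dominated (disjunctive_product G H)"
  shows "well_dominated (disjunctive_product H G)"
  unfolding well_dominated_def
proof (intro allI impI)
  fix D D' assume "minimal_dominating_set (disjunctive_product H G) D"
    "minimal_dominating_set (disjunctive_product H G) D'"
  then have "card (prod.swap ` D) = card (prod.swap ` D')"
    using minimal_dominating_set_swap[OF assms(2,1)] well_dominatedD[OF assms(3)] by blast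
  then show "card D = card D'" by (simp add: card_image)
qed

theorem theorem4:
  fixes G :: "'a pair_pre_digraph" and H :: "'b pair_pre_digraph"
  assumes "pair_graph G" and "pair_graph H"
    and "card (pverts G) \<ge> 2" and "card (pverts H) \<ge> 2"
    and "connected (with_proj G)" and "connected (with_proj H)"
  shows "well_dominated (disjunctive_product G H) \<longleftrightarrow>
           (complete_graph G \<and> well_dominated H \<and> domination_number H \<le> 2) \<or>
           (complete_graph H \<and> well_dominated G \<and> domination_number G \<le> 2)"
proof -
  have ne: "pverts G \<noteq> {}" "pverts H \<noteq> {}" using assms(3,4) by auto
  have comm: "well_dominated (disjunctive_product G H) \<longleftrightarrow>
      well_dominated (disjunctive_product H G)"
    using well_dominated_disjunctive_product_commute[OF assms(1,2)]
      well_dominated_disjunctive_product_commute[OF assms(2,1)] by argo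
  \<comment> \<open>Some factor is complete on either side of the equivalence; \<open>comm\<close>
    reduces the case of complete \<open>H\<close> to that of a complete first factor.\<close>
  show ?thesis
    using well_dominated_complete_product_iff[OF assms(1,2) _ assms(3) ne(2)]
      well_dominated_complete_product_iff[OF assms(2,1) _ assms(4) ne(1)]
      well_dominated_disjunctive_product_imp_complete[OF assms(1,2,5,3)] comm
    by argo
qed

end
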